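(* Let $G$ be a finite simple undirected graph with $n$ vertices and $m$ edges, and let $D^k[G]$ be its $k$-fold graph. Let $p,k,t$ be integers with $k\ge 2$, $t\ge 2k$, $p\ge kn+t$ and $m\le\frac{t(kn+t)}{2k^2}$. Then $$LE(D^k[G]\vee\overline{K_p})=2kn+(p-nk)\frac{2m'}{n'}+2mk^2,$$ where $\frac{2m'}{n'}=\frac{2k^2m+2pkn}{p+kn}$ is the average vertex degree of $D^k[G]\vee\overline{K_p}$.
   Context: The Laplacian energy of a graph $H$ with $N$ vertices, $M$ edges and Laplacian eigenvalues $\nu_1,\dots,\nu_N$ (eigenvalues of $D-A$, with $A$ the adjacency matrix and $D$ the diagonal degree matrix) is $LE(H)=\sum_{i=1}^N|\nu_i-\frac{2M}{N}|$. The $k$-fold graph $D^k[G]$ is obtained by taking $k$ copies of $G$ and joining each vertex in one copy with the neighbours of the corresponding vertices in the other copies; i.e. it has vertex set $V(G)\times\{1,\dots,k\}$ with $(u,a)$ adjacent to $(v,b)$ iff $u$ is adjacent to $v$ in $G$. The join $H_1\vee H_2$ is the disjoint union of $H_1$ and $H_2$ together with all edges between $V(H_1)$ and $V(H_2)$. $\overline{K_p}$ is the edgeless graph on $p$ vertices. *)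

theory Defs
  imports
    Graph_Theory.Pair_Digraph
    Jordan_Normal_Form.Char_Poly
    "HOL-Computational_Algebra.Polynomial"
begin

text \<open>
  A finite simple undirected graph is represented by a \<^locale>\<open>pair_graph\<close>: a finite vertex set with
  a symmetric, loopless arc relation. Every undirected edge therefore occurs as two opposite arcs,
  and the out-degree of a vertex is its degree.
\<close>

definition edges :: "'a pair_pre_digraph \<Rightarrow> 'a set set" where
  "edges H = (\<lambda>(u, v). {u, v}) ` parcs H"

definition kfold_graph :: "nat \<Rightarrow> 'a pair_pre_digraph \<Rightarrow> ('a \<times> nat) pair_pre_digraph" where
  "kfold_graph k G =
    \<lparr> pverts = pverts G \<times> {1..k},
      parcs = {((u, a), (v, b)) | u a v b. (u, v) \<in> parcs G \<and> a \<in> {1..k} \<and> b \<in> {1..k}} \<rparr>"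

definition edgeless_graph :: "nat \<Rightarrow> nat pair_pre_digraph" where
  "edgeless_graph p = \<lparr> pverts = {1..p}, parcs = {} \<rparr>"

definition graph_join ::
    "'a pair_pre_digraph \<Rightarrow> 'b pair_pre_digraph \<Rightarrow> ('a + 'b) pair_pre_digraph" where
  "graph_join H1 H2 =
    \<lparr> pverts = Inl ` pverts H1 \<union> Inr ` pverts H2,
      parcs = {(Inl u, Inl v) | u v. (u, v) \<in> parcs H1}
        \<union> {(Inr u, Inr v) | u v. (u, v) \<in> parcs H2}
        \<union> {(Inl u, Inr v) | u v. u \<in> pverts H1 \<and> v \<in> pverts H2}
        \<union> {(Inr v, Inl u) | u v. u \<in> pverts H1 \<and> v \<in> pverts H2} \<rparr>"

definition adjacency_matrix :: "'a pair_pre_digraph \<Rightarrow> 'a list \<Rightarrow> real mat" where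
  "adjacency_matrix H vs =
    mat (length vs) (length vs) (\<lambda>(i, j). if (vs ! i, vs ! j) \<in> parcs H then 1 else 0)"

definition degree_matrix :: "'a pair_pre_digraph \<Rightarrow> 'a list \<Rightarrow> real mat" where
  "degree_matrix H vs =
    mat (length vs) (length vs)
      (\<lambda>(i, j). if i = j then real (out_degree (with_proj H) (vs ! i)) else 0)"

definition laplacian_matrix :: "'a pair_pre_digraph \<Rightarrow> 'a list \<Rightarrow> real mat" where
  "laplacian_matrix H vs = degree_matrix H vs - adjacency_matrix H vs"

definition vertex_list :: "'a pair_pre_digraph \<Rightarrow> 'a list" where
  "vertex_list H = (SOME vs. distinct vs \<and> set vs = pverts H)"

text \<open>
  The Laplacian eigenvalues with multiplicity. The matrix is real symmetric, so its characteristic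
  polynomial splits over the reals and this multiset has one element for each vertex. It does not
  depend on the chosen vertex list (lemma \<open>laplacian_spectrum_eq\<close> below).
\<close>

definition laplacian_spectrum :: "'a pair_pre_digraph \<Rightarrow> real multiset" where
  "laplacian_spectrum H = proots (char_poly (laplacian_matrix H (vertex_list H)))"

definition laplacian_energy :: "'a pair_pre_digraph \<Rightarrow> real" where
  "laplacian_energy H =
    (\<Sum>\<nu>\<in>#laplacian_spectrum H.
      \<bar>\<nu> - 2 * real (card (edges H)) / real (card (pverts H))\<bar>)"

definition average_degree :: "'a pair_pre_digraph \<Rightarrow> real" where
  "average_degree H =
    (\<Sum>v\<in>pverts H. real (out_degree (with_proj H) v)) / real (card (pverts H))"

lemma pair_graphI:
  assumes "finite (pverts H)"
    and "\<And>u v. (u, v) \<in> parcs H \<Longrightarrow> u \<in> pverts H \<and> v \<in> pverts H \<and> u \<noteq> v \<and> (v, u) \<in> parcs H"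
  shows "pair_graph H"
proof -
  have "parcs H \<subseteq> pverts H \<times> pverts H"
    using assms(2) by auto
  then have "finite (parcs H)"
    using assms(1) by (meson finite_SigmaI finite_subset)
  moreover have "symmetric (with_proj H)"
    using assms(2) by (simp add: symmetric_def sym_def)
  moreover have "fst e \<in> pverts H" "snd e \<in> pverts H" "fst e \<noteq> snd e" if "e \<in> parcs H" for e
    using assms(2)[of "fst e" "snd e"] that by simp_all
  ultimately show ?thesis
    using assms(1) by unfold_locales
qed

lemma pair_graphD:
  assumes "pair_graph H"
  shows "finite (pverts H)"
    and "(u, v) \<in> parcs H \<Longrightarrow> u \<in> pverts H \<and> v \<in> pverts H \<and> u \<noteq> v \<and> (v, u) \<in> parcs H"
proof -
  interpret pair_graph H by fact
  show "finite (pverts H)"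
    by (rule pair_finite_verts)
  show "(u, v) \<in> parcs H \<Longrightarrow> u \<in> pverts H \<and> v \<in> pverts H \<and> u \<noteq> v \<and> (v, u) \<in> parcs H"
    by (blast intro: in_arcsD1 in_arcsD2 arcs_symmetric dest: no_loops')
qed

lemma pair_graph_kfold_graph:
  assumes "pair_graph G"
  shows "pair_graph (kfold_graph k G)"
  using pair_graphD[OF assms] by (intro pair_graphI) (auto simp: kfold_graph_def)

lemma pair_graph_edgeless_graph: "pair_graph (edgeless_graph p)"
  by (rule pair_graphI) (auto simp: edgeless_graph_def)

lemma pair_graph_graph_join:
  assumes "pair_graph H1" and "pair_graph H2"
  shows "pair_graph (graph_join H1 H2)"
  using pair_graphD[OF assms(1)] pair_graphD[OF assms(2)]
  by (intro pair_graphI) (auto simp: graph_join_def)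

lemma char_poly_laplacian_matrix_eq:
  assumes vs: "distinct vs" and ws: "distinct ws" and eq: "set vs = set ws"
  shows "char_poly (laplacian_matrix H vs) = char_poly (laplacian_matrix H ws)"
proof (rule char_poly_similar)
  define n where "n = length vs"
  have n: "length vs = n" "length ws = n"
    using assms by (auto simp: n_def) (metis distinct_card)
  let ?A = "laplacian_matrix H vs" and ?B = "laplacian_matrix H ws"
  have A: "?A \<in> carrier_mat n n" and B: "?B \<in> carrier_mat n n"
    by (auto simp: laplacian_matrix_def degree_matrix_def adjacency_matrix_def n)
  have "\<exists>j. j < n \<and> ws ! j = vs ! i" "\<exists>j. j < n \<and> vs ! j = ws ! i" if "i < n" for i
    using nth_mem[of i vs] nth_mem[of i ws] that n eq by (auto simp: in_set_conv_nth)
  then obtain f g where f: "\<And>i. i < n \<Longrightarrow> f i < n \<and> ws ! f i = vs ! i"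
    and g: "\<And>j. j < n \<Longrightarrow> g j < n \<and> vs ! g j = ws ! j"
    by metis
  have gf: "g (f i) = i" and fg: "f (g i) = i" if "i < n" for i
    using f[of i] g[of "f i"] g[of i] f[of "g i"] that vs ws n
    by (auto simp: nth_eq_iff_index_eq)
  let ?P = "mat n n (\<lambda>(i, j). if j = f i then 1 else 0) :: real mat"
  let ?Q = "mat n n (\<lambda>(i, j). if j = g i then 1 else 0) :: real mat"
  have mul: "mat n n (\<lambda>(i, j). if j = h i then 1 else 0) * M
      = mat n n (\<lambda>(i, j). M $$ (h i, j))"
    if "M \<in> carrier_mat n n" "\<And>i. i < n \<Longrightarrow> h i < n" for M :: "real mat" and h
  proof (rule eq_matI)
    fix i j assume "i < dim_row (mat n n (\<lambda>(i, j). M $$ (h i, j)))"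
      "j < dim_col (mat n n (\<lambda>(i, j). M $$ (h i, j)))"
    with that show "(mat n n (\<lambda>(i, j). if j = h i then 1 else 0) * M) $$ (i, j)
        = mat n n (\<lambda>(i, j). M $$ (h i, j)) $$ (i, j)"
      by (auto simp: scalar_prod_def if_distrib[of "\<lambda>x. x * _"] cong: if_cong)
  qed (use that in auto)
  have PQ: "?P * ?Q = 1\<^sub>m n"
    by (subst mul) (auto simp: f gf)
  have QP: "?Q * ?P = 1\<^sub>m n"
    by (subst mul) (auto simp: g fg)
  have PB: "?P * ?B = mat n n (\<lambda>(i, j). ?B $$ (f i, j))"
    by (rule mul[OF B]) (simp add: f)
  have "?P * ?B * ?Q = ?A"
  proof (rule eq_matI)
    fix i j assume ij: "i < dim_row ?A" "j < dim_col ?A"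
    then have ij': "i < n" "j < n" using A by auto
    have "(?P * ?B * ?Q) $$ (i, j) = (\<Sum>l<n. ?B $$ (f i, l) * (if j = g l then 1 else 0))"
      unfolding PB using ij' by (simp add: scalar_prod_def atLeast0LessThan)
    also have "\<dots> = (\<Sum>l<n. if l = f j then ?B $$ (f i, l) else 0)"
      by (rule sum.cong) (use ij' f g fg gf in auto)
    also have "\<dots> = ?B $$ (f i, f j)"
      using f[OF ij'(2)] by simp
    also have "\<dots> = ?A $$ (i, j)"
      using f[OF ij'(1)] f[OF ij'(2)] ij' gf n
      by (auto simp: laplacian_matrix_def degree_matrix_def adjacency_matrix_def) (metis gf)+
    finally show "(?P * ?B * ?Q) $$ (i, j) = ?A $$ (i, j)" .
  qed (use A in auto)
  with PQ QP A B show "similar_mat ?A ?B"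
    unfolding similar_mat_def similar_mat_wit_def Let_def
    by (intro exI[of _ ?P] exI[of _ ?Q]) auto
qed

lemma laplacian_spectrum_eq:
  assumes "finite (pverts H)" and "distinct vs" and "set vs = pverts H"
  shows "laplacian_spectrum H = proots (char_poly (laplacian_matrix H vs))"
proof -
  have "distinct (vertex_list H) \<and> set (vertex_list H) = pverts H"
    unfolding vertex_list_def by (rule someI_ex) (use assms in blast)
  then show ?thesis
    using char_poly_laplacian_matrix_eq[of "vertex_list H" vs H] assms
    by (simp add: laplacian_spectrum_def)
qed

end

theory Submission
  imports Defs "Jordan_Normal_Form.Schur_Decomposition"
begin

text \<open>
  The energy of \<open>H = D \<or> E\<close>, with \<open>D\<close> the \<open>k\<close>-fold graph on \<open>K = k n\<close> vertices and \<open>E\<close> the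
  edgeless graph on \<open>p\<close> vertices, can be computed without knowing the Laplacian eigenvalues
  \<open>\<lambda>\<close> of \<open>D\<close> one by one. The Laplacian spectrum of a join of nonempty graphs consists of \<open>0\<close> and the total number of
  vertices, together with the nontrivial eigenvalues of either side shifted by the order of the
  other side (\<open>laplacian_spectrum_graph_join\<close>). For \<open>H\<close> these are \<open>0\<close>, \<open>K + p\<close>, the numbers
  \<open>\<lambda> + p\<close> (with one eigenvalue \<open>\<lambda> = 0\<close> left out), and \<open>K\<close> with multiplicity \<open>p - 1\<close>.

  Let \<open>r\<close> be the average degree of \<open>H\<close>. If \<open>K \<le> r \<le> p\<close>, then the sign of \<open>\<nu> - r\<close> is known for
  every eigenvalue \<open>\<nu>\<close>: all \<open>\<lambda>\<close> are nonnegative (\<open>laplacian_spectrum_nonneg\<close>), so that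
  \<open>\<lambda> + p \<ge> r\<close>. The absolute values disappear, and the \<open>\<lambda>\<close> enter only through their number and
  their sum, the trace, which is twice the number of edges of \<open>D\<close> (\<open>sum_laplacian_spectrum\<close>).
  This gives the energy of the join of any graph with an edgeless graph
  (\<open>laplacian_energy_join_edgeless_graph\<close>). Of the \<open>k\<close>-fold graph only the counts of vertices and
  edges matter, \<open>k n\<close> and \<open>k\<^sup>2 m\<close>.

  The hypotheses force \<open>r\<close> into that range. Since
  \<open>r (p + K) = 2 k\<^sup>2 m + 2 p K\<close>, the inequality \<open>r \<le> p\<close> means \<open>2 k\<^sup>2 m \<le> p (p - K)\<close>, which holds
  because \<open>2 k\<^sup>2 m \<le> t (K + t)\<close> and \<open>p \<ge> K + t\<close>; the inequality \<open>K \<le> r\<close> follows from \<open>K \<le> p\<close>.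
\<close>

section \<open>Determinants of block matrices\<close>

text \<open>
  Sylvester's identity. Both sides are the determinant of the block matrix with rows \<open>1, U\<close> and
  \<open>V, 1\<close>: eliminating \<open>V\<close> by row operations leaves one side, by column operations the other.
\<close>

lemma det_one_minus_mult_commute:
  fixes U V :: "'a::idom mat"
  assumes U: "U \<in> carrier_mat n m" and V: "V \<in> carrier_mat m n"
  shows "det (1\<^sub>m n - U * V) = det (1\<^sub>m m - V * U)"
proof -
  let ?L = "four_block_mat (1\<^sub>m n) (0\<^sub>m n m) V (1\<^sub>m m)"
  let ?R = "four_block_mat (1\<^sub>m n) U (0\<^sub>m m n) (1\<^sub>m m - V * U)"
  have L: "det ?L = 1" "?L \<in> carrier_mat (n + m) (n + m)"
    by (subst det_four_block_mat_upper_right_zero[of _ n _ m]) (use V in auto)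
  have R: "?R \<in> carrier_mat (n + m) (n + m)" "1\<^sub>m m - V * U \<in> carrier_mat m m"
    using U V by auto
  have "?L * ?R = four_block_mat (1\<^sub>m n) U V (1\<^sub>m m)"
    by (subst mult_four_block_mat[of _ n n _ m _ m _ _ n _ m]) (use U V in auto)
  then have 1: "det (four_block_mat (1\<^sub>m n) U V (1\<^sub>m m)) = det (1\<^sub>m m - V * U)"
    using det_mult[OF L(2) R(1)] L(1)
      det_four_block_mat_lower_left_zero[OF one_carrier_mat U refl R(2)]
    by simp
  let ?T = "four_block_mat (1\<^sub>m n - U * V) U (0\<^sub>m m n) (1\<^sub>m m)"
  have T: "?T \<in> carrier_mat (n + m) (n + m)" "1\<^sub>m n - U * V \<in> carrier_mat n n"
    using U V by auto
  have "?T * ?L = four_block_mat (1\<^sub>m n) U V (1\<^sub>m m)"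
    by (subst mult_four_block_mat[of _ n n _ m _ m _ _ n _ m]) (use U V in auto)
  then have 2: "det (four_block_mat (1\<^sub>m n) U V (1\<^sub>m m)) = det (1\<^sub>m n - U * V)"
    using det_mult[OF T(1) L(2)] L(1)
      det_four_block_mat_lower_left_zero[OF T(2) U refl one_carrier_mat]
    by simp
  from 1 2 show ?thesis by simp
qed

abbreviation const_mat :: "nat \<Rightarrow> nat \<Rightarrow> 'a \<Rightarrow> 'a mat" where
  "const_mat n m c \<equiv> mat n m (\<lambda>_. c)"

lemma const_mat_mult:
  "const_mat n l a * const_mat l m b = const_mat n m (of_nat l * a * b :: 'a::comm_semiring_1)"
  by (rule eq_matI) (auto simp: scalar_prod_def mult.assoc)

lemma mult_const_mat:
  fixes A :: "'a::comm_semiring_1 mat"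
  assumes "A \<in> carrier_mat n l" and "\<And>i. i < n \<Longrightarrow> (\<Sum>j<l. A $$ (i, j)) = a"
  shows "A * const_mat l m c = const_mat n m (a * c)"
  by (rule eq_matI)
    (use assms in \<open>auto simp: scalar_prod_def sum_distrib_right[symmetric] atLeast0LessThan\<close>)

text \<open>
  The all-ones matrix has rank one, so Sylvester's identity reduces this to a determinant of
  size one.
\<close>

lemma det_one_minus_const_mat:
  "det (1\<^sub>m n - const_mat n n c) = 1 - of_nat n * (c::'a::idom)"
proof -
  have "det (1\<^sub>m n - const_mat n n c) = det (1\<^sub>m n - const_mat n 1 1 * const_mat 1 n c)"
    by (simp add: const_mat_mult)
  also have "\<dots> = det (1\<^sub>m 1 - const_mat 1 n c * const_mat n 1 1)"
    by (rule det_one_minus_mult_commute) auto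
  also have "\<dots> = 1 - of_nat n * c"
    by (subst det_single) (auto simp: const_mat_mult)
  finally show ?thesis .
qed

text \<open>
  The linear algebra behind joins: the off-diagonal blocks of the Laplacian of a join are
  constant. Because the rows of \<open>A\<close> sum to \<open>a\<close>, the constant matrix with entries \<open>1 / a\<close> plays the
  role of the inverse of \<open>A\<close> times the off-diagonal block. The Schur complement of \<open>A\<close> is then
  \<open>B\<close> minus a constant matrix, and the row sums of \<open>B\<close> allow factoring out \<open>B\<close> as well. This works
  even when \<open>A\<close> or \<open>B\<close> is singular.
\<close>

lemma det_four_block_ones:
  fixes A B :: "'a::field mat"
  assumes A: "A \<in> carrier_mat n n" "\<And>i. i < n \<Longrightarrow> (\<Sum>j<n. A $$ (i, j)) = a" "a \<noteq> 0"
    and B: "B \<in> carrier_mat m m" "\<And>i. i < m \<Longrightarrow> (\<Sum>j<m. B $$ (i, j)) = b" "b \<noteq> 0"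
  shows "a * b * det (four_block_mat A (const_mat n m 1) (const_mat m n 1) B)
    = (a * b - of_nat n * of_nat m) * (det A * det B)"
proof -
  let ?c = "of_nat n / (a * b)"
  let ?C = "1\<^sub>m m - const_mat m m ?c"
  let ?L = "four_block_mat A (0\<^sub>m n m) (const_mat m n 1) (1\<^sub>m m)"
  let ?R = "four_block_mat (1\<^sub>m n) (const_mat n m (1 / a)) (0\<^sub>m m n) (B * ?C)"
  have AJ: "A * const_mat n m (1 / a) = const_mat n m 1"
    using A(3) by (simp add: mult_const_mat[OF A(1,2)])
  have "B * ?C = B - B * const_mat m m ?c"
    using B(1) by (subst mult_minus_distrib_mat[OF B(1)]) auto
  also have "B * const_mat m m ?c = const_mat m m (of_nat n / a)"
    using B(3) by (simp add: mult_const_mat[OF B(1,2)])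
  finally have BC: "B * ?C = B - const_mat m m (of_nat n / a)" .
  have car: "?L \<in> carrier_mat (n + m) (n + m)" "?R \<in> carrier_mat (n + m) (n + m)"
    using A B by auto
  have "?L * ?R = four_block_mat A (const_mat n m 1) (const_mat m n 1) B"
    using A B
    by (subst mult_four_block_mat[of _ n n _ m _ m _ _ n _ m])
      (auto simp: AJ BC const_mat_mult intro!: cong_four_block_mat eq_matI)
  then have "det (four_block_mat A (const_mat n m 1) (const_mat m n 1) B) = det ?L * det ?R"
    using det_mult[OF car] by simp
  also have "det ?L = det A"
    by (subst det_four_block_mat_upper_right_zero[OF A(1)]) auto
  also have "det ?R = det (B * ?C)"
    by (subst det_four_block_mat_lower_left_zero[of _ n _ m]) (use B in auto)
  also have "\<dots> = det B * (1 - of_nat m * ?c)"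
    using B(1) by (subst det_mult[OF B(1)]) (auto simp: det_one_minus_const_mat)
  finally show ?thesis
    using A(3) B(3) by (simp add: field_simps)
qed

section \<open>Characteristic polynomials with real roots\<close>

lemma poly_char_poly:
  fixes A :: "'a::field mat"
  assumes "A \<in> carrier_mat n n"
  shows "poly (char_poly A) x = det (x \<cdot>\<^sub>m 1\<^sub>m n - A)"
  unfolding char_poly_def
  by (rule poly_det_cong[of _ n]) (use assms in \<open>auto simp: char_poly_matrix_def\<close>)

lemma prod_linear_factors_nonzero: "(\<Prod>x\<in>#S. [:- x, 1:]) \<noteq> (0 :: 'a::idom poly)"
  by (induction S) (simp_all del: mult_pCons_left)

lemma proots_prod_linear_factors:
  "proots (\<Prod>x\<in>#S. [:- x, 1:]) = (S :: 'a::idom multiset)"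
  by (induction S)
    (simp_all add: proots_mult[OF _ prod_linear_factors_nonzero] del: mult_pCons_left)

text \<open>
  The roots of the characteristic polynomial over the complex numbers are eigenvalues. If these
  are all real, then the factorization into linear factors is one over the reals.
\<close>

lemma char_poly_real_splits:
  fixes A :: "real mat"
  assumes A: "A \<in> carrier_mat n n"
    and real: "\<And>c. eigenvalue (map_mat complex_of_real A) c \<Longrightarrow> c \<in> \<real>"
  shows "char_poly A = (\<Prod>x\<in>#proots (char_poly A). [:- x, 1:])"
proof -
  interpret h: map_poly_inj_comm_ring_hom complex_of_real ..
  let ?C = "map_mat complex_of_real A"
  have C: "?C \<in> carrier_mat n n" using A by auto
  obtain as where as: "char_poly ?C = (\<Prod>a\<leftarrow>as. [:- a, 1:])"
    using char_poly_factorized[OF C] by blast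
  have "complex_of_real (Re c) = c" if "c \<in> set as" for c
  proof -
    have "poly (char_poly ?C) c = 0"
      using that unfolding as by (auto simp: poly_prod_list prod_list_zero_iff)
    then show ?thesis
      using real eigenvalue_root_char_poly[OF C] by simp
  qed
  then have "map_poly complex_of_real (\<Prod>a\<leftarrow>as. [:- Re a, 1:]) = (\<Prod>a\<leftarrow>as. [:- a, 1:])"
    by (induction as) (auto simp: hom_distribs)
  also have "\<dots> = map_poly complex_of_real (char_poly A)"
    using of_real_hom.char_poly_hom[OF A, where 'a = complex] as by simp
  finally have "char_poly A = (\<Prod>a\<leftarrow>as. [:- Re a, 1:])"
    by simp
  also have "\<dots> = (\<Prod>x\<in>#image_mset Re (mset as). [:- x, 1:])"
    by (simp add: prod_mset_prod_list[symmetric] image_mset.compositionality comp_def)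
  finally show ?thesis
    by (metis proots_prod_linear_factors)
qed

lemma sum_diag_similar:
  fixes A B :: "'a::comm_ring_1 mat"
  assumes "similar_mat_wit A B P Q" and "A \<in> carrier_mat n n"
  shows "(\<Sum>i<n. A $$ (i, i)) = (\<Sum>i<n. B $$ (i, i))"
proof -
  note wit = similar_mat_witD2[OF assms(2,1)]
  have com: "(\<Sum>i<n. (X * Y) $$ (i, i)) = (\<Sum>i<n. (Y * X) $$ (i, i))"
    if "X \<in> carrier_mat n n" "Y \<in> carrier_mat n n" for X Y :: "'a mat"
  proof -
    have "(\<Sum>i<n. (X * Y) $$ (i, i)) = (\<Sum>i<n. \<Sum>j<n. X $$ (i, j) * Y $$ (j, i))"
      using that by (auto simp: scalar_prod_def atLeast0LessThan)
    also have "\<dots> = (\<Sum>j<n. \<Sum>i<n. Y $$ (j, i) * X $$ (i, j))"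
      by (subst sum.swap) (simp add: mult.commute)
    also have "\<dots> = (\<Sum>i<n. (Y * X) $$ (i, i))"
      using that by (auto simp: scalar_prod_def atLeast0LessThan)
    finally show ?thesis .
  qed
  have "(\<Sum>i<n. A $$ (i, i)) = (\<Sum>i<n. (P * (B * Q)) $$ (i, i))"
    using wit by (simp add: assoc_mult_mat[of P n n B n Q n])
  also have "\<dots> = (\<Sum>i<n. (B * Q * P) $$ (i, i))"
    using wit by (intro com) auto
  also have "B * Q * P = B"
    using wit by (simp add: assoc_mult_mat[of B n n Q n P n])
  finally show ?thesis .
qed

text \<open>
  A Schur decomposition is a similar upper triangular matrix with the eigenvalues on its diagonal,
  and similar matrices have the same trace.
\<close>

lemma sum_proots_char_poly:
  fixes A :: "real mat"
  assumes A: "A \<in> carrier_mat n n"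
    and splits: "char_poly A = (\<Prod>x\<in>#proots (char_poly A). [:- x, 1:])"
  shows "\<Sum>\<^sub># (proots (char_poly A)) = (\<Sum>i<n. A $$ (i, i))"
proof -
  obtain es where es: "mset es = proots (char_poly A)"
    using ex_mset by blast
  have "char_poly A = (\<Prod>e\<leftarrow>es. [:- e, 1:])"
    by (subst splits) (simp add: es[symmetric] prod_mset_prod_list[symmetric])
  moreover obtain B P Q where BPQ: "schur_decomposition A es = (B, P, Q)"
    by (cases "schur_decomposition A es")
  ultimately have B: "similar_mat_wit A B P Q" "diag_mat B = es"
    using schur_decomposition[OF A] by auto
  have "\<Sum>\<^sub># (proots (char_poly A)) = sum_list (diag_mat B)"
    by (simp add: es[symmetric] B sum_mset_sum_list)
  also have "\<dots> = (\<Sum>i<n. B $$ (i, i))"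
    using similar_mat_witD2[OF A B(1)]
    by (simp add: diag_mat_def interv_sum_list_conv_sum_set_nat atLeast0LessThan)
  finally show ?thesis
    using sum_diag_similar[OF B(1) A] by simp
qed

lemma size_proots_char_poly:
  fixes A :: "'a::idom mat"
  assumes A: "A \<in> carrier_mat n n"
    and splits: "char_poly A = (\<Prod>x\<in>#proots (char_poly A). [:- x, 1:])"
  shows "size (proots (char_poly A)) = n"
proof -
  have "degree (\<Prod>x\<in>#S. [:- x, 1:]) = size S" for S :: "'a multiset"
    by (induction S)
      (simp_all add: degree_mult_eq[OF _ prod_linear_factors_nonzero] del: mult_pCons_left)
  then show ?thesis
    using degree_monic_char_poly[OF A] splits by metis
qed


section \<open>Laplacian spectra\<close>

lemma sum_list_index:
  assumes "distinct vs"
  shows "(\<Sum>i<length vs. f (vs ! i)) = (\<Sum>v\<in>set vs. f v)"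
  using sum.reindex_bij_betw[OF bij_betw_nth[OF assms refl refl]] by simp

lemma out_degree_eq_sum:
  assumes "pair_graph H"
  shows "real (out_degree (with_proj H) u) = (\<Sum>v\<in>pverts H. if (u, v) \<in> parcs H then 1 else 0)"
proof -
  have "out_arcs (with_proj H) u = Pair u ` {v \<in> pverts H. (u, v) \<in> parcs H}"
    using pair_graphD(2)[OF assms] by (auto simp: out_arcs_def)
  then show ?thesis
    using pair_graphD(1)[OF assms]
    by (simp add: out_degree_def card_image inj_on_def sum.If_cases Int_def)
qed

lemma sum_out_degree:
  assumes "pair_graph H"
  shows "(\<Sum>v\<in>pverts H. out_degree (with_proj H) v) = card (parcs H)"
proof -
  interpret pair_graph H by fact
  have "(\<Sum>v\<in>pverts H. \<Sum>e | e \<in> parcs H \<and> fst e = v. 1) = (\<Sum>e\<in>parcs H. 1 :: nat)"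
    by (rule sum.group) (use pair_graphD(2)[OF assms] in auto)
  then show ?thesis
    by (simp add: out_degree_def out_arcs_def)
qed

text \<open>
  The fibre over an edge \<open>{u, v}\<close> consists of the two arcs \<open>(u, v)\<close> and \<open>(v, u)\<close>.
\<close>

lemma card_parcs:
  assumes "pair_graph H"
  shows "card (parcs H) = 2 * card (edges H)"
proof -
  interpret pair_graph H by fact
  let ?f = "\<lambda>(u, v). {u, v}"
  have "card {a \<in> parcs H. ?f a = e} = 2" if e: "e \<in> edges H" for e
  proof -
    obtain u v where uv: "(u, v) \<in> parcs H" "e = {u, v}"
      using e unfolding edges_def by auto
    then have "{a \<in> parcs H. ?f a = e} = {(u, v), (v, u)}" "u \<noteq> v"
      using pair_graphD(2)[OF assms] by (auto simp: doubleton_eq_iff)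
    then show ?thesis by simp
  qed
  moreover have "(\<Sum>e\<in>edges H. \<Sum>a | a \<in> parcs H \<and> ?f a = e. 1) = (\<Sum>a\<in>parcs H. 1 :: nat)"
    by (rule sum.group) (auto simp: edges_def)
  ultimately show ?thesis by simp
qed

lemma laplacian_matrix_carrier: "laplacian_matrix H vs \<in> carrier_mat (length vs) (length vs)"
  by (auto simp: laplacian_matrix_def degree_matrix_def adjacency_matrix_def)

lemma laplacian_matrix_index:
  assumes "i < length vs" "j < length vs"
  shows "laplacian_matrix H vs $$ (i, j)
    = (if i = j then real (out_degree (with_proj H) (vs ! i)) else 0)
      - (if (vs ! i, vs ! j) \<in> parcs H then 1 else 0)"
  using assms by (simp add: laplacian_matrix_def degree_matrix_def adjacency_matrix_def)

lemma laplacian_matrix_row_sum: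
  assumes "pair_graph H" and "distinct vs" and "set vs = pverts H" and "i < length vs"
  shows "(\<Sum>j<length vs. laplacian_matrix H vs $$ (i, j)) = 0"
  using assms sum_list_index[OF assms(2), of "\<lambda>v. if (vs ! i, v) \<in> parcs H then 1 else 0 :: real"]
  by (simp add: laplacian_matrix_index sum_subtractf out_degree_eq_sum)

text \<open>
  The identity \<open>x\<^sup>* L x = \<Sum> |x u - x v|\<^sup>2\<close>, with the sum over the edges; on the right each edge is
  counted once in each direction, whence the factor 2. The left-hand side spells out \<open>L x\<close> for
  functions on the vertices, which avoids an enumeration of the vertices. The proof adds the
  double sum over pairs \<open>(u, v)\<close> to itself with \<open>u\<close> and \<open>v\<close> exchanged.
\<close>

lemma laplacian_quadratic_form:
  fixes x :: "'a \<Rightarrow> complex"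
  assumes "pair_graph H"
  shows "2 * (\<Sum>u\<in>pverts H. cnj (x u) * (of_nat (out_degree (with_proj H) u) * x u
        - (\<Sum>v\<in>pverts H. if (u, v) \<in> parcs H then x v else 0)))
    = of_real (\<Sum>u\<in>pverts H. \<Sum>v\<in>pverts H.
        if (u, v) \<in> parcs H then (cmod (x u - x v))\<^sup>2 else 0)"
proof -
  let ?a = "\<lambda>u v. if (u, v) \<in> parcs H then 1 else 0 :: complex"
  let ?q = "\<lambda>u v. ?a u v * (cnj (x u) * x u - cnj (x u) * x v)"
  have deg: "of_nat (out_degree (with_proj H) u) = (\<Sum>v\<in>pverts H. ?a u v)" for u
    using arg_cong[OF out_degree_eq_sum[OF assms, of u], of complex_of_real]
    by (simp add: if_distrib[of complex_of_real] cong: if_cong)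
  have "2 * (\<Sum>u\<in>pverts H. cnj (x u) * (of_nat (out_degree (with_proj H) u) * x u
        - (\<Sum>v\<in>pverts H. if (u, v) \<in> parcs H then x v else 0)))
      = 2 * (\<Sum>u\<in>pverts H. \<Sum>v\<in>pverts H. ?q u v)"
    by (intro arg_cong[of _ _ "(*) 2"] sum.cong refl)
      (auto simp: deg sum_distrib_left sum_distrib_right sum_subtractf[symmetric]
        algebra_simps intro!: sum.cong)
  also have "\<dots> = (\<Sum>u\<in>pverts H. \<Sum>v\<in>pverts H. ?q u v) + (\<Sum>u\<in>pverts H. \<Sum>v\<in>pverts H. ?q v u)"
    by (subst (3) sum.swap) (rule mult_2)
  also have "\<dots> = (\<Sum>u\<in>pverts H. \<Sum>v\<in>pverts H. ?q u v + ?q v u)"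
    by (simp only: sum.distrib)
  also have "(\<lambda>u v. ?q u v + ?q v u)
      = (\<lambda>u v. of_real (if (u, v) \<in> parcs H then (cmod (x u - x v))\<^sup>2 else 0))"
  proof (intro ext)
    fix u v
    have "(u, v) \<in> parcs H \<longleftrightarrow> (v, u) \<in> parcs H"
      using pair_graphD(2)[OF assms] by blast
    then show "?q u v + ?q v u
        = of_real (if (u, v) \<in> parcs H then (cmod (x u - x v))\<^sup>2 else 0)"
      by (simp add: complex_norm_square algebra_simps del: of_real_power)
  qed
  finally show ?thesis
    by (simp only: of_real_sum)
qed

text \<open>
  For an eigenvector \<open>x\<close> with eigenvalue \<open>c\<close>, the quadratic form is \<open>c\<close> times the squared norm of
  \<open>x\<close>, and it is also a real nonnegative number. So \<open>c\<close> is a quotient of two such numbers. Working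
  with complex vectors gives reality and nonnegativity at once.
\<close>

lemma laplacian_eigenvalue_real_nonneg:
  assumes H: "pair_graph H" and vs: "distinct vs" "set vs = pverts H"
    and ev: "eigenvalue (map_mat complex_of_real (laplacian_matrix H vs)) c"
  shows "c \<in> \<real> \<and> 0 \<le> Re c"
proof -
  let ?n = "length vs" and ?L = "map_mat complex_of_real (laplacian_matrix H vs)"
  have L: "?L \<in> carrier_mat ?n ?n"
    using laplacian_matrix_carrier by auto
  obtain y where y: "y \<in> carrier_vec ?n" "y \<noteq> 0\<^sub>v ?n" "?L *\<^sub>v y = c \<cdot>\<^sub>v y"
    using ev L unfolding eigenvalue_def eigenvector_def by auto
  \<comment> \<open>the eigenvector as a function on the vertices\<close>
  define x where "x v = y $ (THE i. i < ?n \<and> vs ! i = v)" for v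
  have x: "x (vs ! i) = y $ i" if "i < ?n" for i
  proof -
    have "(THE j. j < ?n \<and> vs ! j = vs ! i) = i"
      using that vs(1) by (auto simp: nth_eq_iff_index_eq)
    then show ?thesis by (simp add: x_def)
  qed
  have Lx: "of_nat (out_degree (with_proj H) u) * x u
      - (\<Sum>v\<in>pverts H. if (u, v) \<in> parcs H then x v else 0) = c * x u"
    if "u \<in> pverts H" for u
  proof -
    obtain i where i: "i < ?n" "u = vs ! i"
      using \<open>u \<in> pverts H\<close> vs(2) by (metis in_set_conv_nth)
    have "c * x u = (?L *\<^sub>v y) $ i"
      using y i by (simp add: x)
    also have "\<dots> = (\<Sum>j<?n. of_real (laplacian_matrix H vs $$ (i, j)) * y $ j)"
      using L y(1) i(1) by (simp add: scalar_prod_def atLeast0LessThan)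
    also have "\<dots> = (\<Sum>j<?n. (if i = j then of_nat (out_degree (with_proj H) u) * x u else 0)
        - (if (u, vs ! j) \<in> parcs H then x (vs ! j) else 0))"
      by (intro sum.cong refl)
        (use i x in \<open>auto simp: laplacian_matrix_index algebra_simps\<close>)
    also have "\<dots> = of_nat (out_degree (with_proj H) u) * x u
      - (\<Sum>v\<in>pverts H. if (u, v) \<in> parcs H then x v else 0)"
      using i(1) sum_list_index[OF vs(1), of "\<lambda>v. if (u, v) \<in> parcs H then x v else 0"] vs(2)
      by (simp add: sum_subtractf)
    finally show ?thesis ..
  qed
  define N where "N = (\<Sum>u\<in>pverts H. (cmod (x u))\<^sup>2)"
  define Q where "Q = (\<Sum>u\<in>pverts H. \<Sum>v\<in>pverts H.
    if (u, v) \<in> parcs H then (cmod (x u - x v))\<^sup>2 else 0)"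
  have "2 * (c * of_real N) = 2 * (\<Sum>u\<in>pverts H. cnj (x u) * (c * x u))"
    by (simp add: N_def sum_distrib_left complex_norm_square mult_ac del: of_real_power)
  also have "\<dots> = of_real Q"
    using laplacian_quadratic_form[OF H, of x] Lx by (simp add: Q_def)
  finally have cN: "2 * (c * of_real N) = of_real Q" .
  obtain i where "i < ?n" "y $ i \<noteq> 0"
    using y(1,2) by (metis carrier_vecD eq_vecI index_zero_vec)
  then have "x (vs ! i) \<noteq> 0" "vs ! i \<in> pverts H"
    using x vs(2) nth_mem[of i vs] by simp_all
  then have N: "N > 0"
    unfolding N_def using pair_graphD(1)[OF H] by (intro sum_pos2[of _ "vs ! i"]) auto
  have "Q \<ge> 0"
    unfolding Q_def by (intro sum_nonneg) auto
  moreover have "c = of_real (Q / (2 * N))"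
    using cN N by (simp add: field_simps)
  ultimately show ?thesis using N by simp
qed

lemma pair_graph_vertex_listE:
  assumes "pair_graph H"
  obtains vs where "distinct vs" "set vs = pverts H" "length vs = card (pverts H)"
  using finite_distinct_list[OF pair_graphD(1)[OF assms]] distinct_card by metis

lemma char_poly_laplacian_splits:
  assumes "pair_graph H" and "distinct vs" and "set vs = pverts H"
  shows "char_poly (laplacian_matrix H vs) = (\<Prod>x\<in>#laplacian_spectrum H. [:- x, 1:])"
  unfolding laplacian_spectrum_eq[OF pair_graphD(1)[OF assms(1)] assms(2,3)]
  using laplacian_eigenvalue_real_nonneg[OF assms]
  by (intro char_poly_real_splits[OF laplacian_matrix_carrier]) blast

lemma laplacian_spectrum_nonneg:
  assumes H: "pair_graph H" and "x \<in># laplacian_spectrum H"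
  shows "0 \<le> x"
proof -
  obtain vs where vs: "distinct vs" "set vs = pverts H"
    using pair_graph_vertex_listE[OF H] .
  let ?L = "laplacian_matrix H vs"
  have "char_poly ?L \<noteq> 0"
    using degree_monic_char_poly[OF laplacian_matrix_carrier[of H vs]] by auto
  then have "poly (char_poly ?L) x = 0"
    using assms(2) laplacian_spectrum_eq[OF pair_graphD(1)[OF H] vs] by simp
  then have "eigenvalue ?L x"
    by (simp add: eigenvalue_root_char_poly[OF laplacian_matrix_carrier])
  then have "eigenvalue (map_mat complex_of_real ?L) (of_real x)"
    by (rule of_real_hom.eigenvalue_hom[OF laplacian_matrix_carrier])
  then show ?thesis
    using laplacian_eigenvalue_real_nonneg[OF H vs] by force
qed

lemma size_laplacian_spectrum:
  assumes H: "pair_graph H"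
  shows "size (laplacian_spectrum H) = card (pverts H)"
proof -
  obtain vs where vs: "distinct vs" "set vs = pverts H" "length vs = card (pverts H)"
    using pair_graph_vertex_listE[OF H] .
  note eq = laplacian_spectrum_eq[OF pair_graphD(1)[OF H] vs(1,2)]
  show ?thesis
    unfolding eq vs(3)[symmetric]
    by (rule size_proots_char_poly[OF laplacian_matrix_carrier])
      (use char_poly_laplacian_splits[OF H vs(1,2)] eq in simp)
qed

lemma sum_laplacian_spectrum:
  assumes H: "pair_graph H"
  shows "\<Sum>\<^sub># (laplacian_spectrum H) = real (card (parcs H))"
proof -
  obtain vs where vs: "distinct vs" "set vs = pverts H"
    using pair_graph_vertex_listE[OF H] .
  note eq = laplacian_spectrum_eq[OF pair_graphD(1)[OF H] vs]
  have "\<Sum>\<^sub># (laplacian_spectrum H) = (\<Sum>i<length vs. laplacian_matrix H vs $$ (i, i))"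
    unfolding eq
    by (rule sum_proots_char_poly[OF laplacian_matrix_carrier])
      (use char_poly_laplacian_splits[OF H vs] eq in simp)
  also have "\<dots> = (\<Sum>i<length vs. real (out_degree (with_proj H) (vs ! i)))"
    using pair_graphD(2)[OF H] by (intro sum.cong refl) (auto simp: laplacian_matrix_index)
  also have "\<dots> = real (card (parcs H))"
    using sum_list_index[OF vs(1), of "\<lambda>v. out_degree (with_proj H) v"] vs(2) sum_out_degree[OF H]
    by (simp flip: of_nat_sum)
  finally show ?thesis .
qed

section \<open>The spectrum of a join\<close>

lemma pverts_graph_join: "pverts (graph_join H1 H2) = pverts H1 <+> pverts H2"
  by (simp add: graph_join_def Plus_def)

lemma card_pverts_graph_join:
  assumes "pair_graph H1" and "pair_graph H2"
  shows "card (pverts (graph_join H1 H2)) = card (pverts H1) + card (pverts H2)"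
  using pair_graphD(1)[OF assms(1)] pair_graphD(1)[OF assms(2)]
  by (simp add: pverts_graph_join card_Plus)

lemma out_degree_graph_join:
  assumes "pair_graph H1" and "pair_graph H2"
  shows "u \<in> pverts H1 \<Longrightarrow> out_degree (with_proj (graph_join H1 H2)) (Inl u)
      = out_degree (with_proj H1) u + card (pverts H2)"
    and "v \<in> pverts H2 \<Longrightarrow> out_degree (with_proj (graph_join H1 H2)) (Inr v)
      = out_degree (with_proj H2) v + card (pverts H1)"
proof -
  note fin = pair_graphD(1)[OF assms(1)] pair_graphD(1)[OF assms(2)]
  note J = out_degree_eq_sum[OF pair_graph_graph_join[OF assms]]
  have split: "(\<Sum>w\<in>pverts (graph_join H1 H2). f w)
      = (\<Sum>w\<in>pverts H1. f (Inl w)) + (\<Sum>w\<in>pverts H2. f (Inr w))"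
    for f :: "_ \<Rightarrow> real"
    using fin by (simp add: pverts_graph_join sum.Plus)
  show "out_degree (with_proj (graph_join H1 H2)) (Inl u)
      = out_degree (with_proj H1) u + card (pverts H2)" if "u \<in> pverts H1"
  proof -
    have "real (out_degree (with_proj (graph_join H1 H2)) (Inl u))
        = real (out_degree (with_proj H1) u) + real (card (pverts H2))"
      unfolding J split out_degree_eq_sum[OF assms(1)] using that by (simp add: graph_join_def)
    then show ?thesis by linarith
  qed
  show "out_degree (with_proj (graph_join H1 H2)) (Inr v)
      = out_degree (with_proj H2) v + card (pverts H1)" if "v \<in> pverts H2"
  proof -
    have "real (out_degree (with_proj (graph_join H1 H2)) (Inr v))
        = real (out_degree (with_proj H2) v) + real (card (pverts H1))"
      unfolding J split out_degree_eq_sum[OF assms(2)] using that by (simp add: graph_join_def)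
    then show ?thesis by linarith
  qed
qed

lemma laplacian_matrix_graph_join:
  assumes H: "pair_graph H1" "pair_graph H2"
    and vs: "set vs = pverts H1" "length vs = card (pverts H1)" "distinct vs"
    and ws: "set ws = pverts H2" "length ws = card (pverts H2)" "distinct ws"
  shows "x \<cdot>\<^sub>m 1\<^sub>m (length vs + length ws)
      - laplacian_matrix (graph_join H1 H2) (map Inl vs @ map Inr ws)
    = four_block_mat
        ((x - real (length ws)) \<cdot>\<^sub>m 1\<^sub>m (length vs) - laplacian_matrix H1 vs)
        (const_mat (length vs) (length ws) 1)
        (const_mat (length ws) (length vs) 1)
        ((x - real (length vs)) \<cdot>\<^sub>m 1\<^sub>m (length ws) - laplacian_matrix H2 ws)"
    (is "?l = ?r")
proof (rule eq_matI)
  note car = laplacian_matrix_carrier[of H1 vs] laplacian_matrix_carrier[of H2 ws]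
    laplacian_matrix_carrier[of "graph_join H1 H2" "map Inl vs @ map Inr ws"]
  show "dim_row ?l = dim_row ?r" "dim_col ?l = dim_col ?r" using car by auto
  fix i j assume "i < dim_row ?r" "j < dim_col ?r"
  then have ij: "i < length vs + length ws" "j < length vs + length ws" using car by auto
  have mem: "i < length vs \<Longrightarrow> vs ! i \<in> pverts H1" "i < length ws \<Longrightarrow> ws ! i \<in> pverts H2" for i
    using vs(1) ws(1) by auto
  have arcs: "(Inl u, Inl v) \<in> parcs (graph_join H1 H2) \<longleftrightarrow> (u, v) \<in> parcs H1"
    "(Inr u', Inr v') \<in> parcs (graph_join H1 H2) \<longleftrightarrow> (u', v') \<in> parcs H2"
    "(Inl u, Inr v') \<in> parcs (graph_join H1 H2) \<longleftrightarrow> u \<in> pverts H1 \<and> v' \<in> pverts H2"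
    "(Inr u', Inl v) \<in> parcs (graph_join H1 H2) \<longleftrightarrow> u' \<in> pverts H2 \<and> v \<in> pverts H1"
    for u v u' v'
    by (auto simp: graph_join_def)
  show "?l $$ (i, j) = ?r $$ (i, j)"
    using ij car
    by (auto simp: laplacian_matrix_index nth_append arcs mem out_degree_graph_join[OF H]
        vs(2) ws(2))
qed

text \<open>
  At every number \<open>x\<close> other than \<open>n\<close> and \<open>m\<close> the identity is an instance of
  \<open>det_four_block_ones\<close>: the Laplacians have row sums 0, so the diagonal blocks have the nonzero row
  sums \<open>a = x - m\<close> and \<open>b = x - n\<close>, and \<open>a b - n m = x (x - (n + m))\<close>. Polynomials that agree at
  infinitely many points are equal.
\<close>

lemma char_poly_laplacian_graph_join:
  assumes H: "pair_graph H1" "pair_graph H2"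
    and vs: "set vs = pverts H1" "length vs = card (pverts H1)" "distinct vs"
    and ws: "set ws = pverts H2" "length ws = card (pverts H2)" "distinct ws"
  defines "n \<equiv> real (length vs)" and "m \<equiv> real (length ws)"
  shows "[:- m, 1:] * [:- n, 1:]
      * char_poly (laplacian_matrix (graph_join H1 H2) (map Inl vs @ map Inr ws))
    = [:0, 1:] * [:- (n + m), 1:]
      * (pcompose (char_poly (laplacian_matrix H1 vs)) [:- m, 1:]
        * pcompose (char_poly (laplacian_matrix H2 ws)) [:- n, 1:])"
    (is "?l = ?r")
proof (rule ccontr)
  assume "?l \<noteq> ?r"
  then have "finite {x. poly (?l - ?r) x = 0}"
    by (intro poly_roots_finite) simp
  moreover have "- {n, m} \<subseteq> {x. poly (?l - ?r) x = 0}"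
  proof
    fix x assume "x \<in> - {n, m}"
    then have x: "x - m \<noteq> 0" "x - n \<noteq> 0" by auto
    let ?A = "(x - m) \<cdot>\<^sub>m 1\<^sub>m (length vs) - laplacian_matrix H1 vs"
    let ?B = "(x - n) \<cdot>\<^sub>m 1\<^sub>m (length ws) - laplacian_matrix H2 ws"
    let ?J = "laplacian_matrix (graph_join H1 H2) (map Inl vs @ map Inr ws)"
    note car = laplacian_matrix_carrier[of H1 vs] laplacian_matrix_carrier[of H2 ws]
    have J: "?J \<in> carrier_mat (length vs + length ws) (length vs + length ws)"
      using laplacian_matrix_carrier[of "graph_join H1 H2" "map Inl vs @ map Inr ws"] by simp
    have A: "?A \<in> carrier_mat (length vs) (length vs)"
      and B: "?B \<in> carrier_mat (length ws) (length ws)"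
      using car by auto
    have rowA: "(\<Sum>j<length vs. ?A $$ (i, j)) = x - m" if "i < length vs" for i
      using that car laplacian_matrix_row_sum[OF H(1) vs(3,1) that]
      by (simp add: sum_subtractf if_distrib[of "(*) (x - m)"] cong: if_cong)
    have rowB: "(\<Sum>j<length ws. ?B $$ (i, j)) = x - n" if "i < length ws" for i
      using that car laplacian_matrix_row_sum[OF H(2) ws(3,1) that]
      by (simp add: sum_subtractf if_distrib[of "(*) (x - n)"] cong: if_cong)
    have "(x - m) * (x - n) * poly (char_poly ?J) x
        = ((x - m) * (x - n) - n * m) * (det ?A * det ?B)"
      using det_four_block_ones[OF A rowA x(1) B rowB x(2)] poly_char_poly[OF J, of x]
        laplacian_matrix_graph_join[OF H vs ws, of x]
      by (simp add: n_def m_def)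
    then have "poly ?l x = poly ?r x"
      using poly_char_poly[OF car(1), of "x - m"] poly_char_poly[OF car(2), of "x - n"]
      by (simp add: poly_pcompose algebra_simps)
    then show "x \<in> {x. poly (?l - ?r) x = 0}" by simp
  qed
  ultimately have "finite (- {n, m})" by (rule finite_subset[rotated])
  then show False by (simp add: finite_compl infinite_UNIV_char_0)
qed

lemma pcompose_prod_linear_factors:
  "pcompose (\<Prod>x\<in>#S. [:- x, 1:]) [:- c, 1:] = (\<Prod>x\<in>#image_mset ((+) c) S. [:- x, 1:])"
  for c :: "'a::comm_ring_1"
  by (induction S) (auto simp: pcompose_mult pcompose_pCons pcompose_1 minus_diff_commute simp del: mult_pCons_left)

text \<open>
  Each side has the trivial eigenvalue 0, which the shifts turn into \<open>m\<close> and \<open>n\<close>; the join has 0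
  and \<open>n + m\<close> in their place. Adding \<open>m\<close> and \<open>n\<close> on the left instead of removing them on the right
  keeps the statement free of multiset differences, and it remains true when one of the graphs has
  no vertices and hence no trivial eigenvalue.
\<close>

lemma laplacian_spectrum_graph_join:
  assumes H: "pair_graph H1" "pair_graph H2"
  defines "n \<equiv> real (card (pverts H1))" and "m \<equiv> real (card (pverts H2))"
  shows "{#m, n#} + laplacian_spectrum (graph_join H1 H2)
    = {#0, n + m#} + image_mset ((+) m) (laplacian_spectrum H1)
        + image_mset ((+) n) (laplacian_spectrum H2)"
proof -
  obtain vs where vs: "distinct vs" "set vs = pverts H1" "length vs = card (pverts H1)"
    using pair_graph_vertex_listE[OF H(1)] .
  obtain ws where ws: "distinct ws" "set ws = pverts H2" "length ws = card (pverts H2)"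
    using pair_graph_vertex_listE[OF H(2)] .
  have us: "distinct (map Inl vs @ map Inr ws)"
    "set (map Inl vs @ map Inr ws) = pverts (graph_join H1 H2)"
    using vs ws by (auto simp: distinct_map graph_join_def)
  let ?F = "\<lambda>S. \<Prod>x\<in>#S. [:- x, 1:] :: real poly"
  have "?F ({#m, n#} + laplacian_spectrum (graph_join H1 H2))
      = ?F ({#0, n + m#} + image_mset ((+) m) (laplacian_spectrum H1)
        + image_mset ((+) n) (laplacian_spectrum H2))"
    using char_poly_laplacian_graph_join[OF H vs(2,3,1) ws(2,3,1)]
    unfolding char_poly_laplacian_splits[OF H(1) vs(1,2)] char_poly_laplacian_splits[OF H(2) ws(1,2)]
      char_poly_laplacian_splits[OF pair_graph_graph_join[OF H] us] pcompose_prod_linear_factors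
    by (simp add: vs(3) ws(3) n_def m_def mult.assoc del: mult_pCons_left mult_pCons_right)
  then show ?thesis
    by (metis proots_prod_linear_factors)
qed

lemma card_parcs_graph_join:
  assumes "pair_graph H1" and "pair_graph H2"
  shows "card (parcs (graph_join H1 H2))
    = card (parcs H1) + card (parcs H2) + 2 * card (pverts H1) * card (pverts H2)"
  using pair_graphD(1)[OF assms(1)] pair_graphD(1)[OF assms(2)]
  by (simp add: sum_out_degree[OF pair_graph_graph_join[OF assms], symmetric]
      sum_out_degree[OF assms(1), symmetric] sum_out_degree[OF assms(2), symmetric]
      pverts_graph_join sum.Plus out_degree_graph_join[OF assms] sum.distrib)

section \<open>The Laplacian energy of a join with an edgeless graph\<close>

text \<open>
  The eigenvalues are nonnegative and their sum, twice the number of edges, is 0.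
\<close>

lemma laplacian_spectrum_edgeless_graph:
  "laplacian_spectrum (edgeless_graph p) = replicate_mset p 0"
proof -
  note H = pair_graph_edgeless_graph[of p]
  let ?S = "laplacian_spectrum (edgeless_graph p)"
  have "x = 0" if "x \<in># ?S" for x
  proof -
    obtain S where S: "?S = add_mset x S"
      using \<open>x \<in># ?S\<close> by (metis multi_member_split)
    have "(\<Sum>y\<in>#S. 0) \<le> (\<Sum>y\<in>#S. y)"
      using laplacian_spectrum_nonneg[OF H] S by (intro sum_mset_mono) auto
    then have "sum_mset S \<ge> 0" by simp
    moreover have "x + sum_mset S = 0"
      using sum_laplacian_spectrum[OF H] S by (simp add: edgeless_graph_def)
    moreover have "x \<ge> 0"
      using laplacian_spectrum_nonneg[OF H] S by simp
    ultimately show "x = 0" by linarith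
  qed
  then have "?S = replicate_mset (size ?S) 0"
    by (intro set_mset_subset_singletonD) auto
  then show ?thesis
    using size_laplacian_spectrum[OF H] by (simp add: edgeless_graph_def)
qed

text \<open>
  The bounds on \<open>r\<close> fix the sign of \<open>\<nu> - r\<close> for every eigenvalue \<open>\<nu>\<close> of the join, so that only the
  number and the sum of the eigenvalues of \<open>H\<close> remain.
\<close>

lemma laplacian_energy_join_edgeless_graph:
  fixes p :: nat
  assumes H: "pair_graph H"
  defines "n \<equiv> real (card (pverts H))" and "J \<equiv> graph_join H (edgeless_graph p)"
  defines "r \<equiv> 2 * real (card (edges J)) / real (card (pverts J))"
  assumes r: "n \<le> r" "r \<le> real p"
  shows "laplacian_energy J = 2 * n + (real p - n) * r + 2 * real (card (edges H))"
proof -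
  let ?E = "edgeless_graph p"
  let ?dev = "\<lambda>S. \<Sum>x\<in>#S. \<bar>x - r\<bar>"
  have p: "real (card (pverts ?E)) = real p"
    by (simp add: edgeless_graph_def)
  have "?dev (image_mset ((+) (real p)) (laplacian_spectrum H))
      = (\<Sum>x\<in>#laplacian_spectrum H. x + (real p - r))"
    unfolding image_mset.compositionality comp_def
    by (intro arg_cong[of _ _ sum_mset] image_mset_cong)
      (use laplacian_spectrum_nonneg[OF H] r in force)
  also have "\<dots> = 2 * real (card (edges H)) + n * (real p - r)"
    using sum_laplacian_spectrum[OF H] size_laplacian_spectrum[OF H] card_parcs[OF H]
    by (simp add: sum_mset.distrib n_def)
  finally have devH: "?dev (image_mset ((+) (real p)) (laplacian_spectrum H))
      = 2 * real (card (edges H)) + n * (real p - r)" .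
  \<comment> \<open>the two extra terms belong to the elements added in \<open>laplacian_spectrum_graph_join\<close>\<close>
  have "\<bar>real p - r\<bar> + \<bar>n - r\<bar> + laplacian_energy J
      = ?dev ({#real p, n#} + laplacian_spectrum J)"
    by (simp add: laplacian_energy_def r_def)
  also have "\<dots> = ?dev ({#0, n + real p#} + image_mset ((+) (real p)) (laplacian_spectrum H)
      + image_mset ((+) n) (laplacian_spectrum ?E))"
    using laplacian_spectrum_graph_join[OF H pair_graph_edgeless_graph, of p]
    by (simp only: p n_def[symmetric] J_def[symmetric])
  also have "\<dots> = \<bar>r\<bar> + \<bar>n + real p - r\<bar> + (2 * real (card (edges H)) + n * (real p - r))
      + real p * \<bar>n - r\<bar>"
    using devH by (simp add: laplacian_spectrum_edgeless_graph)
  finally show ?thesis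
    using r by (simp add: n_def[symmetric] algebra_simps) (auto simp: n_def)
qed

lemma card_pverts_kfold_graph: "card (pverts (kfold_graph k G)) = k * card (pverts G)"
  by (simp add: kfold_graph_def card_cartesian_product)

lemma card_parcs_kfold_graph: "card (parcs (kfold_graph k G)) = k\<^sup>2 * card (parcs G)"
proof -
  let ?f = "\<lambda>((u, v), (a, b)). ((u, a), (v, b))"
  have "parcs (kfold_graph k G) = ?f ` (parcs G \<times> {1..k} \<times> {1..k})"
    by (force simp: kfold_graph_def)
  moreover have "inj_on ?f (parcs G \<times> {1..k} \<times> {1..k})"
    by (auto simp: inj_on_def)
  ultimately show ?thesis
    by (simp add: card_image card_cartesian_product power2_eq_square)
qed

lemma average_degree_eq:
  assumes "pair_graph H"
  shows "average_degree H = 2 * real (card (edges H)) / real (card (pverts H))"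
  using sum_out_degree[OF assms] card_parcs[OF assms]
  by (simp add: average_degree_def flip: of_nat_sum)

theorem theorem4p7:
  fixes G :: "'a pair_pre_digraph" and n m p k t n' m' :: nat
    and H :: "('a \<times> nat + nat) pair_pre_digraph"
  assumes "pair_graph G"
    and "n = card (pverts G)" and "m = card (edges G)"
    and "k \<ge> 2" and "t \<ge> 2 * k" and "p \<ge> k * n + t"
    and "real m \<le> real t * (real k * real n + real t) / (2 * (real k)\<^sup>2)"
    and "H = graph_join (kfold_graph k G) (edgeless_graph p)"
    and "n' = card (pverts H)" and "m' = card (edges H)"
  shows "laplacian_energy H
        = 2 * real k * real n + (real p - real n * real k) * (2 * real m' / real n')
          + 2 * real m * (real k)\<^sup>2
      \<and> 2 * real m' / real n'
        = (2 * (real k)\<^sup>2 * real m + 2 * real p * real k * real n) / (real p + real k * real n)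
      \<and> average_degree H = 2 * real m' / real n'"
proof -
  let ?D = "kfold_graph k G" and ?E = "edgeless_graph p"
  let ?K = "real k * real n" and ?r = "2 * real m' / real n'"
  note G = \<open>pair_graph G\<close>
  note D = pair_graph_kfold_graph[OF G, of k] and E = pair_graph_edgeless_graph[of p]
  have H: "pair_graph H"
    using pair_graph_graph_join[OF D E] assms(8) by simp
  have n': "real n' = real p + ?K"
    using card_pverts_graph_join[OF D E] assms(2,8,9)
    by (simp add: card_pverts_kfold_graph) (simp add: edgeless_graph_def)
  have mD: "card (edges ?D) = k\<^sup>2 * m"
    using card_parcs[OF D] card_parcs[OF G] assms(3) by (simp add: card_parcs_kfold_graph)
  have "2 * m' = 2 * (k\<^sup>2 * m) + 2 * (k * n) * p"
    using card_parcs_graph_join[OF D E] card_parcs[OF H] card_parcs[OF D] mD assms(2,8,10)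
    by (simp add: card_pverts_kfold_graph) (simp add: edgeless_graph_def)
  from arg_cong[OF this, of real]
  have m': "2 * real m' = 2 * (real k)\<^sup>2 * real m + 2 * real p * ?K"
    by (simp add: mult_ac)
  have k: "real k > 0" and p: "real p \<ge> ?K + real t" and t: "real t > 0"
    using assms(4-6) by (auto simp flip: of_nat_mult of_nat_add)
  have K: "?K \<ge> 0" by simp
  have n'_pos: "real n' > 0"
    using n' p t K by linarith
  have "2 * (real k)\<^sup>2 * real m \<le> real t * (?K + real t)"
    using assms(7) k by (simp add: field_simps)
  also have "\<dots> \<le> (real p - ?K) * real p"
    using p t K by (intro mult_mono) auto
  finally have "2 * real m' \<le> real p * real n'"
    unfolding m' n' by (simp add: algebra_simps)
  then have r_le: "?r \<le> real p"
    using n'_pos by (simp add: field_simps)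
  have "?K * ?K \<le> ?K * real p"
    using p t K by (intro mult_left_mono) auto
  then have "?K * real n' \<le> 2 * (real k)\<^sup>2 * real m + 2 * real p * ?K"
    unfolding n' by (simp add: algebra_simps add_increasing2)
  then have r_ge: "?K \<le> ?r"
    using n'_pos m' by (simp add: field_simps)
  have "laplacian_energy H = 2 * ?K + (real p - ?K) * ?r + 2 * real (card (edges ?D))"
    using laplacian_energy_join_edgeless_graph[OF D, of p] r_ge r_le assms(2,8,9,10)
    by (simp add: card_pverts_kfold_graph)
  then have "laplacian_energy H = 2 * real k * real n + (real p - real n * real k) * ?r
      + 2 * real m * (real k)\<^sup>2"
    by (simp add: mD mult_ac)
  moreover have "?r = (2 * (real k)\<^sup>2 * real m + 2 * real p * real k * real n)
      / (real p + real k * real n)"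
    using m' n' by (simp add: mult.assoc)
  moreover have "average_degree H = ?r"
    using average_degree_eq[OF H] assms(9,10) by simp
  ultimately show ?thesis by blast
qed

end
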